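(* Let $\alpha$ be any positive real and let $r\geq 2$ be any integer such that $r\alpha\geq 1$. Let $A(\alpha,r)$ be an algorithm solving fuel-constrained exploration for all instances of $\mathcal{I}(\alpha,r)$. Then for every positive integer $k$ there exists an instance $(G=(V,E),l_s,\alpha)$ of $\mathcal{I}(\alpha,r)$ such that $|V|\geq k$ and for which the penalty of $A$ is at least $\frac{|V|^2}{8\alpha}$.
   Context: Model. A mobile agent explores a finite, simple, undirected, connected graph $G=(V,E)$ starting from a source node $s$. Nodes have pairwise distinct integer labels; at each node $v$ the incident edges carry distinct local port numbers $0,\dots,\deg(v)-1$, with no relation between the two ports of an edge. Initially the agent knows only the label and degree of $s$. It runs a deterministic algorithm: at each step the algorithm, based on everything memorized so far, chooses a port at the current node and the agent traverses the corresponding edge; on arrival it learns the label and degree of the new node and the incoming port number. The agent has unbounded memory. Exploration requires traversing every edge (hence visiting every node) at least once. Fuel-constrained exploration: let $r$ be the eccentricity of $s$ in $G$ and $\alpha>0$ a real constant with $r\alpha\geq 1$. The agent has a fuel tank of size $B=2(1+\alpha)r$ that can be refilled only at $s$: it may make at most $\lfloor B\rfloor$ edge traversals between two consecutive visits to $s$ (starting from $s$). Both $\alpha$ and $r$ are given to the algorithm in advance. An instance is a tuple $(G,l_s,\alpha)$ where $l_s$ is the label of $s$; $\mathcal{I}(\alpha,r)$ denotes the set of all instances $(G,l_s,\alpha)$ in which the eccentricity of the node labeled $l_s$ is $r$. The penalty of an algorithm on an instance with graph $G=(V,E)$ is the number of edge traversals it performs in excess of $|E|$. *)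

theory Defs
  imports Complex_Main "HOL-Library.Sublist"
begin

text \<open>
  Nodes are identified with their (pairwise distinct) integer labels, and \<open>port G u v\<close>
  is the port number that the edge \<open>{u, v}\<close> carries at \<open>u\<close>.
\<close>

record port_graph =
  nodes :: "int set"
  edges :: "int set set"
  port :: "int \<Rightarrow> int \<Rightarrow> nat"

definition adjacent :: "port_graph \<Rightarrow> int \<Rightarrow> int \<Rightarrow> bool" where
  "adjacent G u v \<longleftrightarrow> {u, v} \<in> edges G"

definition neighbours :: "port_graph \<Rightarrow> int \<Rightarrow> int set" where
  "neighbours G v = {w. adjacent G v w}"

definition degree :: "port_graph \<Rightarrow> int \<Rightarrow> nat" where
  "degree G v = card (neighbours G v)"

definition simple_connected_port_graph :: "port_graph \<Rightarrow> bool" where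
  "simple_connected_port_graph G \<longleftrightarrow>
     finite (nodes G) \<and>
     edges G \<subseteq> {{u, v} | u v. u \<in> nodes G \<and> v \<in> nodes G \<and> u \<noteq> v} \<and>
     (\<forall>u\<in>nodes G. \<forall>v\<in>nodes G. (adjacent G)\<^sup>*\<^sup>* u v) \<and>
     (\<forall>v\<in>nodes G. bij_betw (port G v) (neighbours G v) {0..<degree G v})"

definition distance :: "port_graph \<Rightarrow> int \<Rightarrow> int \<Rightarrow> nat" where
  "distance G u v = (LEAST n. (adjacent G ^^ n) u v)"

definition eccentricity :: "port_graph \<Rightarrow> int \<Rightarrow> nat" where
  "eccentricity G s = Max (distance G s ` nodes G)"

type_synonym problem = "port_graph \<times> int \<times> real"

definition instances :: "real \<Rightarrow> nat \<Rightarrow> problem set" where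
  "instances \<alpha> r = {(G, l, \<alpha>) | G l.
     simple_connected_port_graph G \<and> l \<in> nodes G \<and> eccentricity G l = r}"

text \<open>
  What the agent has memorized: label and degree of the starting node and, for each traversal
  made so far, the outgoing port, the label and degree of the node reached, and the incoming port.
  An algorithm maps this to the port to take next, or to \<open>None\<close> to stop.
\<close>

type_synonym memory = "(int \<times> nat) \<times> (nat \<times> int \<times> nat \<times> nat) list"
type_synonym algorithm = "memory \<Rightarrow> nat option"

definition memory_of :: "port_graph \<Rightarrow> int list \<Rightarrow> memory" where
  "memory_of G w =
     ((hd w, degree G (hd w)),
      map (\<lambda>(u, v). (port G u v, v, degree G v, port G v u)) (zip w (tl w)))"

text \<open>
  \<open>run A G s w\<close>: started at \<open>s\<close>, the agent at some time has visited exactly the nodes \<open>w\<close> in this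
  order, having made \<open>length w - 1\<close> traversals. A run cannot be continued, and is not halted, after
  \<open>A\<close> has chosen a port that does not exist at the current node.
\<close>

inductive run :: "algorithm \<Rightarrow> port_graph \<Rightarrow> int \<Rightarrow> int list \<Rightarrow> bool" for A G s where
  start: "run A G s [s]"
| move: "run A G s w \<Longrightarrow> A (memory_of G w) = Some p \<Longrightarrow>
    v \<in> neighbours G (last w) \<Longrightarrow> port G (last w) v = p \<Longrightarrow> run A G s (w @ [v])"

definition halted_run :: "algorithm \<Rightarrow> port_graph \<Rightarrow> int \<Rightarrow> int list \<Rightarrow> bool" where
  "halted_run A G s w \<longleftrightarrow> run A G s w \<and> A (memory_of G w) = None"

definition traverses_all_edges :: "port_graph \<Rightarrow> int list \<Rightarrow> bool" where
  "traverses_all_edges G w \<longleftrightarrow> (\<forall>e\<in>edges G. \<exists>i. Suc i < length w \<and> e = {w ! i, w ! Suc i})"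

text \<open>
  The node \<open>w ! j\<close> need not be \<open>s\<close>, so that the traversals made after the last visit to \<open>s\<close>
  are subject to the same bound.
\<close>

definition respects_fuel :: "real \<Rightarrow> int \<Rightarrow> int list \<Rightarrow> bool" where
  "respects_fuel B s w \<longleftrightarrow>
     (\<forall>i j. i < j \<longrightarrow> j < length w \<longrightarrow> w ! i = s \<longrightarrow> (\<forall>t. i < t \<and> t < j \<longrightarrow> w ! t \<noteq> s) \<longrightarrow>
        int (j - i) \<le> \<lfloor>B\<rfloor>)"

fun solves_fuel_constrained :: "algorithm \<Rightarrow> problem \<Rightarrow> bool" where
  "solves_fuel_constrained A (G, s, \<alpha>) \<longleftrightarrow>
     (\<exists>w. halted_run A G s w \<and> traverses_all_edges G w \<and>
          respects_fuel (2 * (1 + \<alpha>) * real (eccentricity G s)) s w)"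

text \<open>Only meaningful if the algorithm halts; the halted run is then unique, as shown below.\<close>

fun penalty :: "algorithm \<Rightarrow> problem \<Rightarrow> real" where
  "penalty A (G, s, \<alpha>) =
     real (length (THE w. halted_run A G s w) - 1) - real (card (edges G))"

lemma run_last_in_nodes:
  assumes "simple_connected_port_graph G" "s \<in> nodes G" "run A G s w"
  shows "w \<noteq> [] \<and> last w \<in> nodes G"
  using assms(3)
proof induction
  case start
  then show ?case using assms(2) by simp
next
  case (move w p v)
  from move.hyps(3) have "{last w, v} \<in> edges G"
    by (simp add: neighbours_def adjacent_def)
  then obtain a b where "{last w, v} = {a, b}" "a \<in> nodes G" "b \<in> nodes G"
    using assms(1) unfolding simple_connected_port_graph_def by blast
  then show ?case by (auto simp: doubleton_eq_iff)
qed

lemma run_prefix_comparable: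
  assumes "simple_connected_port_graph G" "s \<in> nodes G" "run A G s w" "run A G s w'"
  shows "prefix w w' \<or> strict_prefix w' w"
  using assms(3)
proof induction
  case start
  from assms(4) have "prefix [s] w'" by induction auto
  then show ?case by simp
next
  case (move w p v)
  show ?case
  proof (cases "prefix w w' \<and> w \<noteq> w'")
    case False
    then show ?thesis using move.IH by (auto simp: strict_prefix_def)
  next
    case True
    from assms(4) True have "prefix (w @ [v]) w'"
    proof induction
      case start
      then show ?case using run_last_in_nodes[OF assms(1,2) move.hyps(1)]
        by (auto simp: prefix_Cons)
    next
      case (move w' p' v')
      show ?case
      proof (cases "w = w'")
        case True
        have "inj_on (port G (last w)) (neighbours G (last w))"
          using assms(1) run_last_in_nodes[OF assms(1,2) \<open>run A G s w\<close>]
          by (auto simp: simple_connected_port_graph_def bij_betw_def)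
        moreover have "port G (last w) v = port G (last w) v'"
          using True move.hyps \<open>A (memory_of G w) = Some p\<close> \<open>port G (last w) v = p\<close> by simp
        ultimately have "v = v'"
          using True move.hyps(3) \<open>v \<in> neighbours G (last w)\<close> by (auto dest: inj_onD)
        then show ?thesis using True by simp
      next
        case False
        then show ?thesis using move.IH move.prems by auto
      qed
    qed
    then show ?thesis by simp
  qed
qed

lemma run_continued:
  assumes "run A G s w'" "strict_prefix w w'" "w \<noteq> []"
  shows "A (memory_of G w) \<noteq> None"
  using assms
proof induction
  case start
  then show ?case by (auto simp: strict_prefix_def prefix_Cons)
next
  case (move w1 p v)
  from move.prems(1) have "w = w1 \<or> strict_prefix w w1"
    by (auto simp: strict_prefix_def)
  then show ?case using move.hyps(2) move.IH move.prems(2) by auto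
qed

lemma halted_run_unique:
  assumes "simple_connected_port_graph G" "s \<in> nodes G"
    and "halted_run A G s w" "halted_run A G s w'"
  shows "w = w'"
proof -
  have r: "run A G s w" "run A G s w'"
    and n: "A (memory_of G w) = None" "A (memory_of G w') = None"
    using assms(3,4) by (simp_all add: halted_run_def)
  have ne: "w \<noteq> []" "w' \<noteq> []"
    using run_last_in_nodes[OF assms(1,2)] r by simp_all
  have "\<not> strict_prefix w w'" "\<not> strict_prefix w' w"
    using run_continued[OF r(2) _ ne(1)] run_continued[OF r(1) _ ne(2)] n by blast+
  then show ?thesis
    using run_prefix_comparable[OF assms(1,2) r] by (auto simp: strict_prefix_def)
qed

end

theory Submission
  imports Defs
begin

text \<open>
  Attach a clique \<open>K\<close> on \<open>m\<close> nodes to the far end of a path of length \<open>r - 1\<close> starting at the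
  source, joining all of \<open>K\<close> to the last node of the path. A trip between two visits to the source
  that uses an edge of \<open>K\<close> spends at least \<open>2r\<close> traversals outside \<open>K\<close>, hence at most \<open>2\<alpha>r\<close>
  inside. So \<open>x\<close> traversals inside \<open>K\<close> require about \<open>x/\<alpha>\<close> traversals outside. There are
  \<open>m(m - 1)/2\<close> edges inside \<open>K\<close> but only \<open>m + r - 1\<close> outside, so almost all of the outside
  traversals are penalty, which is thus about \<open>m\<^sup>2/(2\<alpha>)\<close>, whatever the algorithm and the ports are.
\<close>

section \<open>Excursions from level 0 and steps at the top level\<close>

text \<open>An excursion from level 0 that makes a top step and returns needs at least
  \<open>r\<close> other steps up and \<open>r\<close> down, so the fuel bound leaves at most
  \<open>2 * \<alpha> * r\<close> top steps, that is, at most \<alpha> times its other steps. The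
  excursion still open at time \<open>N\<close> is only bounded by a whole tank, whence the additive
  term.\<close>

lemma top_level_steps_bounded:
  fixes d :: "nat \<Rightarrow> nat" and \<alpha> :: real and r N :: nat
  defines "x \<equiv> \<lambda>t. card {j. j < t \<and> d j = r \<and> d (Suc j) = r}"
  assumes "\<alpha> \<ge> 0" and "d 0 = 0"
    and up: "\<And>t. t < N \<Longrightarrow> d (Suc t) \<le> Suc (d t)"
    and down: "\<And>t. t < N \<Longrightarrow> d t \<le> Suc (d (Suc t))"
    and fuel: "\<And>i j. i < j \<Longrightarrow> j \<le> N \<Longrightarrow> d i = 0 \<Longrightarrow> (\<And>t. i < t \<Longrightarrow> t < j \<Longrightarrow> d t \<noteq> 0) \<Longrightarrow>
      real (j - i) \<le> 2 * (1 + \<alpha>) * real r"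
  shows "real (x N) \<le> \<alpha> * (real N - real (x N)) + 2 * (1 + \<alpha>) * real r"
proof -
  define y where "y = (\<lambda>t. real t - real (x t))"
  have x_Suc: "x (Suc t) = (if d t = r \<and> d (Suc t) = r then Suc (x t) else x t)" for t
  proof (cases "d t = r \<and> d (Suc t) = r")
    case True
    then have "{j. j < Suc t \<and> d j = r \<and> d (Suc j) = r} =
        insert t {j. j < t \<and> d j = r \<and> d (Suc j) = r}"
      by (auto simp: less_Suc_eq)
    with True show ?thesis by (simp add: x_def)
  next
    case False
    then have "{j. j < Suc t \<and> d j = r \<and> d (Suc j) = r} = {j. j < t \<and> d j = r \<and> d (Suc j) = r}"
      by (auto simp: less_Suc_eq)
    with False show ?thesis by (auto simp: x_def)
  qed
  \<comment> \<open>\<open>i\<close> is the time of the last visit to level 0.\<close>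
  have inv: "\<exists>i\<le>t. d i = 0 \<and> (\<forall>j. i < j \<and> j \<le> t \<longrightarrow> d j \<noteq> 0) \<and> real (x i) \<le> \<alpha> * y i \<and>
      x i \<le> x t \<and> (if x t = x i then real (d t) \<le> y t - y i else 2 * real r - real (d t) \<le> y t - y i)"
    if "t \<le> N" for t
    using that
  proof (induction t)
    case 0
    show ?case using assms(3) by (auto simp: x_def y_def)
  next
    case (Suc t)
    then obtain i where i: "i \<le> t" "d i = 0" "\<And>j. i < j \<Longrightarrow> j \<le> t \<Longrightarrow> d j \<noteq> 0"
      "real (x i) \<le> \<alpha> * y i" "x i \<le> x t"
      "if x t = x i then real (d t) \<le> y t - y i else 2 * real r - real (d t) \<le> y t - y i"
      by (metis Suc_leD)
    have le: "x i \<le> x (Suc t)" using i(5) by (simp add: x_Suc)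
    \<comment> \<open>\<open>y\<close> counts the steps that are not top steps, and \<open>d\<close>
      changes by at most one in each. The bound switches at the first top step of the excursion,
      where \<open>d t = r\<close> and both bounds equal \<open>r\<close>.\<close>
    have step: "if x (Suc t) = x i then real (d (Suc t)) \<le> y (Suc t) - y i
        else 2 * real r - real (d (Suc t)) \<le> y (Suc t) - y i"
      using i(5,6) up[of t] down[of t] Suc.prems by (auto simp: y_def x_Suc split: if_splits)
    show ?case
    proof (cases "d (Suc t) = 0")
      case False
      then show ?thesis using i le step by (intro exI[of _ i]) (auto simp: le_Suc_eq)
    next
      case True
      have "real (x (Suc t)) - real (x i) \<le> \<alpha> * (y (Suc t) - y i)"
      proof (cases "x (Suc t) = x i")
        case True
        then have "0 \<le> y (Suc t) - y i" using step by simp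
        then show ?thesis using True assms(2) by simp
      next
        case False
        then have ge: "2 * real r \<le> y (Suc t) - y i" using step True by simp
        have "real (Suc t - i) \<le> 2 * (1 + \<alpha>) * real r"
          using i(1-3) Suc.prems by (intro fuel) auto
        \<comment> \<open>The length of the closed excursion splits into top steps and other steps;
          the latter use up at least \<open>2 * r\<close> of the tank.\<close>
        then have "real (x (Suc t)) - real (x i) + (y (Suc t) - y i) \<le> 2 * (1 + \<alpha>) * real r"
          using i(1) by (simp add: y_def of_nat_diff)
        then have "real (x (Suc t)) - real (x i) \<le> \<alpha> * (2 * real r)"
          using ge by (simp add: algebra_simps)
        also have "\<dots> \<le> \<alpha> * (y (Suc t) - y i)"
          using ge assms(2) by (intro mult_left_mono) auto
        finally show ?thesis .
      qed
      then have "real (x (Suc t)) \<le> \<alpha> * y (Suc t)"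
        using i(4) by (simp add: algebra_simps)
      then show ?thesis using True by (intro exI[of _ "Suc t"]) auto
    qed
  qed
  obtain i where i: "i \<le> N" "d i = 0" "\<And>j. i < j \<Longrightarrow> j \<le> N \<Longrightarrow> d j \<noteq> 0"
    "real (x i) \<le> \<alpha> * y i" "x i \<le> x N"
    "if x N = x i then real (d N) \<le> y N - y i else 2 * real r - real (d N) \<le> y N - y i"
    using inv[of N] by auto
  have y_mono: "y i \<le> y N"
    using \<open>i \<le> N\<close>
  proof (induction rule: dec_induct)
    case (step n)
    have "y n \<le> y (Suc n)" by (simp add: y_def x_Suc)
    then show ?case using step.IH by simp
  qed simp
  \<comment> \<open>The excursion open at time \<open>N\<close> may be empty; \<open>fuel\<close>
    speaks only of \<open>i < j\<close>, so that case is separate.\<close>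
  have "real (N - i) \<le> 2 * (1 + \<alpha>) * real r"
  proof (cases "i = N")
    case False
    then show ?thesis using i(1-3) by (intro fuel) auto
  qed (use assms(2) in simp)
  then have "real (x N) - real (x i) \<le> 2 * (1 + \<alpha>) * real r"
    using i(1) y_mono by (simp add: y_def of_nat_diff)
  moreover have "\<alpha> * y i \<le> \<alpha> * y N" using y_mono assms(2) by (intro mult_left_mono) auto
  ultimately show ?thesis using i(4) by (simp add: y_def)
qed

section \<open>The lollipop graph and its distances\<close>

definition clique_nodes :: "nat \<Rightarrow> nat \<Rightarrow> int set" where
  "clique_nodes r m = {int r..<int (r + m)}"

definition lollipop_edges :: "nat \<Rightarrow> nat \<Rightarrow> int set set" where
  "lollipop_edges r m =
     {e. e \<subseteq> clique_nodes r m \<and> card e = 2} \<union>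
     (\<lambda>v. {int r - 1, v}) ` clique_nodes r m \<union>
     (\<lambda>u. {u, u + 1}) ` {0..<int r - 1}"

text \<open>The source is node 0. Any port numbering will do, as the lower bound does not depend on
  it; hence the choice by \<open>SOME\<close>.\<close>

definition lollipop :: "nat \<Rightarrow> nat \<Rightarrow> port_graph" where
  "lollipop r m =
     \<lparr>nodes = {0..<int (r + m)}, edges = lollipop_edges r m,
      port = (\<lambda>u. SOME f. bij_betw f {v. {u, v} \<in> lollipop_edges r m}
                {0..<card {v. {u, v} \<in> lollipop_edges r m}})\<rparr>"

lemma nodes_lollipop [simp]: "nodes (lollipop r m) = {0..<int (r + m)}"
  by (simp add: lollipop_def)

text \<open>Closed form of the distance from the source; on the nodes, the value \<open>r\<close>
  marks exactly the clique.\<close>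

definition level :: "nat \<Rightarrow> int \<Rightarrow> nat" where
  "level r v = min (nat v) r"

text \<open>The last path node \<open>r - 1\<close> and the attached clique form one larger clique,
  so a single inequality covers two of the three edge classes.\<close>

lemma adjacent_lollipop_iff:
  assumes "r > 0"
  shows "adjacent (lollipop r m) u v \<longleftrightarrow>
    u \<in> {0..<int (r + m)} \<and> v \<in> {0..<int (r + m)} \<and> u \<noteq> v \<and>
    (v = u + 1 \<or> u = v + 1 \<or> int r - 1 \<le> u \<and> int r - 1 \<le> v)"
  using assms
  by (auto simp: adjacent_def lollipop_def lollipop_edges_def clique_nodes_def image_iff
      doubleton_eq_iff card_insert_if)

lemma level_adjacent_le:
  assumes "r > 0" "adjacent (lollipop r m) u v"
  shows "level r v \<le> Suc (level r u)"
  using assms by (auto simp: adjacent_lollipop_iff level_def)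

lemma adjacent_sym: "adjacent G u v \<Longrightarrow> adjacent G v u"
  by (simp add: adjacent_def insert_commute)

text \<open>Lower half of the distance: a step raises the level by at most one.\<close>

lemma level_le_relpowp:
  assumes "r > 0" "(adjacent (lollipop r m) ^^ n) 0 v"
  shows "level r v \<le> n"
  using assms(2)
proof (induction n arbitrary: v)
  case (Suc n)
  then obtain u where "(adjacent (lollipop r m) ^^ n) 0 u" "adjacent (lollipop r m) u v" by auto
  then show ?case using Suc.IH level_adjacent_le[OF assms(1)] by (meson Suc_le_mono order_trans)
qed (simp add: level_def)

lemma relpowp_path:
  assumes "r > 0" "n < r"
  shows "(adjacent (lollipop r m) ^^ n) 0 (int n)"
  using assms(2)
proof (induction n)
  case (Suc n)
  then have "adjacent (lollipop r m) (int n) (int (Suc n))"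
    using assms(1) by (auto simp: adjacent_lollipop_iff)
  then show ?case using Suc by (auto intro: relcomppI)
qed simp

text \<open>Upper half of the distance: follow the path to \<open>v\<close>, or to its far end and
  then take one step into the clique.\<close>

lemma relpowp_level:
  assumes "r > 0" "v \<in> nodes (lollipop r m)"
  shows "(adjacent (lollipop r m) ^^ level r v) 0 v"
proof (cases "v < int r")
  case True
  then show ?thesis using relpowp_path[OF assms(1), of "nat v" m] assms(2)
    by (simp add: level_def)
next
  case False
  then have "adjacent (lollipop r m) (int (r - 1)) v"
    using assms by (auto simp: adjacent_lollipop_iff)
  then have "(adjacent (lollipop r m) ^^ Suc (r - 1)) 0 v"
    by (rule relpowp_Suc_I[OF relpowp_path[OF assms(1)], rotated]) (use assms(1) in simp)
  then show ?thesis using False assms(1) by (simp add: level_def)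
qed

lemma distance_lollipop:
  assumes "r > 0" "v \<in> nodes (lollipop r m)"
  shows "distance (lollipop r m) 0 v = level r v"
  unfolding distance_def
  using relpowp_level[OF assms] level_le_relpowp[OF assms(1)] by (rule Least_equality)

lemma eccentricity_lollipop:
  assumes "r > 0" "m > 0"
  shows "eccentricity (lollipop r m) 0 = r"
  unfolding eccentricity_def
proof (rule Max_eqI)
  show "finite (distance (lollipop r m) 0 ` nodes (lollipop r m))" by simp
  show "k \<le> r" if "k \<in> distance (lollipop r m) 0 ` nodes (lollipop r m)" for k
    using that distance_lollipop[OF assms(1)] by (auto simp: level_def)
  have "int r \<in> nodes (lollipop r m)" using assms(2) by simp
  then show "r \<in> distance (lollipop r m) 0 ` nodes (lollipop r m)"
    using distance_lollipop[OF assms(1), of "int r" m]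
    by (intro image_eqI[of _ _ "int r"]) (auto simp: level_def)
qed

text \<open>Any two nodes are connected through the source, adjacency being symmetric. The choice by
  \<open>SOME\<close> yields valid ports because neighbourhoods are finite.\<close>

lemma simple_connected_lollipop:
  assumes "r > 0"
  shows "simple_connected_port_graph (lollipop r m)"
  unfolding simple_connected_port_graph_def
proof (intro conjI ballI)
  let ?G = "lollipop r m"
  show "finite (nodes ?G)" by simp
  show "edges ?G \<subseteq> {{u, v} | u v. u \<in> nodes ?G \<and> v \<in> nodes ?G \<and> u \<noteq> v}"
  proof
    fix e assume e: "e \<in> edges ?G"
    then have "\<exists>u v. e = {u, v}"
      by (auto simp: lollipop_def lollipop_edges_def card_2_iff)
    then obtain u v where "e = {u, v}" by blast
    moreover from this e have "adjacent ?G u v" by (simp add: adjacent_def)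
    ultimately show "e \<in> {{u, v} | u v. u \<in> nodes ?G \<and> v \<in> nodes ?G \<and> u \<noteq> v}"
      using assms by (auto simp: adjacent_lollipop_iff)
  qed
  show "(adjacent ?G)\<^sup>*\<^sup>* u v" if "u \<in> nodes ?G" "v \<in> nodes ?G" for u v
  proof -
    have "(adjacent ?G)\<^sup>*\<^sup>* 0 u" "(adjacent ?G)\<^sup>*\<^sup>* 0 v"
      using relpowp_level[OF assms] that by (blast intro: relpowp_imp_rtranclp)+
    moreover have "symp (adjacent ?G)" by (auto intro: sympI adjacent_sym)
    ultimately show ?thesis by (meson rtranclp_trans sympD symp_rtranclp)
  qed
  show "bij_betw (port ?G v) (neighbours ?G v) {0..<degree ?G v}" if "v \<in> nodes ?G" for v
  proof -
    have nb: "neighbours ?G v = {w. {v, w} \<in> lollipop_edges r m}"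
      by (simp add: neighbours_def adjacent_def lollipop_def)
    have "neighbours ?G v \<subseteq> {0..<int (r + m)}"
      using assms by (auto simp: neighbours_def adjacent_lollipop_iff)
    then have "finite (neighbours ?G v)" by (rule finite_subset) simp
    then have "\<exists>f. bij_betw f (neighbours ?G v) {0..<card (neighbours ?G v)}"
      by (rule ex_bij_betw_finite_nat)
    from someI_ex[OF this] show ?thesis by (simp add: nb degree_def) (simp add: lollipop_def)
  qed
qed

lemma card_clique_edges: "card {e. e \<subseteq> clique_nodes r m \<and> card e = 2} = m choose 2"
  by (simp add: n_subsets clique_nodes_def)

text \<open>A union bound over the three edge classes; an upper bound suffices because the penalty
  subtracts this number.\<close>

lemma card_lollipop_edges_le: "card (edges (lollipop r m)) \<le> (m choose 2) + m + r"
proof -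
  have "card ((\<lambda>v. {int r - 1, v}) ` clique_nodes r m) \<le> m"
    using card_image_le[of "clique_nodes r m" "\<lambda>v. {int r - 1, v}"] by (simp add: clique_nodes_def)
  moreover have "card ((\<lambda>u::int. {u, u + 1}) ` {0..<int r - 1}) \<le> r"
    using card_image_le[of "{0..<int r - 1}" "\<lambda>u. {u, u + 1}"] by simp
  ultimately show ?thesis
    using card_Un_le[of "{e. e \<subseteq> clique_nodes r m \<and> card e = 2} \<union> (\<lambda>v. {int r - 1, v}) ` clique_nodes r m"
        "(\<lambda>u. {u, u + 1}) ` {0..<int r - 1}"]
      card_Un_le[of "{e. e \<subseteq> clique_nodes r m \<and> card e = 2}" "(\<lambda>v. {int r - 1, v}) ` clique_nodes r m"]
    by (simp add: lollipop_def lollipop_edges_def card_clique_edges)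
qed

section \<open>From runs to the penalty\<close>

lemma run_is_walk:
  assumes "run A G s w"
  shows "w \<noteq> [] \<and> w ! 0 = s \<and> (\<forall>i. Suc i < length w \<longrightarrow> adjacent G (w ! i) (w ! Suc i))"
  using assms
proof induction
  case (move w p v)
  have "adjacent G (w ! i) v" if "Suc i = length w" for i
  proof -
    have "i = length w - 1" using that by simp
    then show ?thesis using move by (simp add: neighbours_def last_conv_nth)
  qed
  then show ?case using move.IH
    by (auto simp: nth_append less_Suc_eq)
qed simp

lemma penalty_eq:
  assumes "simple_connected_port_graph G" "s \<in> nodes G" "halted_run A G s w"
  shows "penalty A (G, s, \<alpha>) = real (length w - 1) - real (card (edges G))"
proof -
  have "(THE w. halted_run A G s w) = w"
    using assms halted_run_unique by (intro the_equality) blast+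
  then show ?thesis by simp
qed

text \<open>Every clique edge costs a top step, and top steps force about 1/\<alpha> as many other
  steps. In the penalty the top steps pay for the clique edges, so the other steps remain, less at
  most \<open>m + r\<close> for the edges outside the clique.\<close>

lemma penalty_lollipop_ge:
  assumes "\<alpha> > 0" "r > 0" "m > 0"
    and "solves_fuel_constrained A (lollipop r m, 0, \<alpha>)"
  shows "penalty A (lollipop r m, 0, \<alpha>) \<ge>
    (real (m choose 2) - 2 * (1 + \<alpha>) * real r) / \<alpha> - real m - real r"
proof -
  let ?G = "lollipop r m"
  obtain w where w: "halted_run A ?G 0 w" "traverses_all_edges ?G w"
    "respects_fuel (2 * (1 + \<alpha>) * real r) 0 w"
    using assms(4) eccentricity_lollipop[OF assms(2,3)] by auto
  have walk: "w \<noteq> []" "w ! 0 = 0" "\<And>i. Suc i < length w \<Longrightarrow> adjacent ?G (w ! i) (w ! Suc i)"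
    using run_is_walk w(1) unfolding halted_run_def by blast+
  define N where "N = length w - 1"
  define d where "d = (\<lambda>t. level r (w ! t))"
  define S where "S = {j. j < N \<and> d j = r \<and> d (Suc j) = r}"
  \<comment> \<open>\<open>nat\<close> sends negative labels to 0, so level 0 identifies the source
    only among nonnegative labels.\<close>
  have in_nodes: "w ! t \<ge> 0" if "t < length w" for t
  proof (cases t)
    case 0
    then show ?thesis using walk(2) by simp
  next
    case (Suc i)
    then show ?thesis using walk(3)[of i] that assms(2) by (simp add: adjacent_lollipop_iff)
  qed
  have d_0_iff: "d t = 0 \<longleftrightarrow> w ! t = 0" if "t < length w" for t
    using in_nodes[OF that] assms(2) by (auto simp: d_def level_def min_def)
  have "real (card S) \<le> \<alpha> * (real N - real (card S)) + 2 * (1 + \<alpha>) * real r"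
    unfolding S_def
  proof (rule top_level_steps_bounded)
    show "\<alpha> \<ge> 0" using assms(1) by simp
    show "d 0 = 0" using walk by (simp add: d_def level_def)
    show "d (Suc t) \<le> Suc (d t)" "d t \<le> Suc (d (Suc t))" if "t < N" for t
    proof -
      have "adjacent ?G (w ! t) (w ! Suc t)" using that by (intro walk(3)) (simp add: N_def)
      then show "d (Suc t) \<le> Suc (d t)" "d t \<le> Suc (d (Suc t))"
        using level_adjacent_le[OF assms(2)] adjacent_sym unfolding d_def by blast+
    qed
    show "real (j - i) \<le> 2 * (1 + \<alpha>) * real r"
      if "i < j" "j \<le> N" "d i = 0" "\<And>t. i < t \<Longrightarrow> t < j \<Longrightarrow> d t \<noteq> 0" for i j
    proof -
      have j: "j < length w" using that(2) walk(1) by (auto simp: N_def le_less_trans)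
      have "w ! i = 0" using d_0_iff that(1,3) j by simp
      moreover have "\<forall>t. i < t \<and> t < j \<longrightarrow> w ! t \<noteq> 0" using d_0_iff that(4) j by auto
      ultimately have "int (j - i) \<le> \<lfloor>2 * (1 + \<alpha>) * real r\<rfloor>"
        using w(3) that(1) j unfolding respects_fuel_def by blast
      then show ?thesis by linarith
    qed
  qed
  moreover have "m choose 2 \<le> card S"
  proof -
    \<comment> \<open>Both ends of a clique edge have level \<open>r\<close>, so any step traversing
      it is counted in \<open>S\<close>.\<close>
    have "{e. e \<subseteq> clique_nodes r m \<and> card e = 2} \<subseteq> (\<lambda>j. {w ! j, w ! Suc j}) ` S"
    proof
      fix e assume e: "e \<in> {e. e \<subseteq> clique_nodes r m \<and> card e = 2}"
      then have "e \<in> edges ?G" by (simp add: lollipop_def lollipop_edges_def)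
      then obtain j where j: "Suc j < length w" "e = {w ! j, w ! Suc j}"
        using w(2) unfolding traverses_all_edges_def by blast
      then have "j \<in> S" using e by (auto simp: S_def d_def N_def level_def clique_nodes_def)
      then show "e \<in> (\<lambda>j. {w ! j, w ! Suc j}) ` S" using j(2) by blast
    qed
    moreover have "finite S" by (simp add: S_def)
    ultimately show ?thesis unfolding card_clique_edges[of r m, symmetric]
      by (intro surj_card_le)
  qed
  moreover have "penalty A (?G, 0, \<alpha>) = real N - real (card (edges ?G))"
    unfolding N_def using penalty_eq[OF simple_connected_lollipop[OF assms(2)] _ w(1)] assms(2)
    by simp
  moreover have "real (card (edges ?G)) \<le> real (m choose 2) + real m + real r"
    using card_lollipop_edges_le[of r m] by linarith
  moreover have "(real (card S) - 2 * (1 + \<alpha>) * real r) / \<alpha> \<le> real N - real (card S)"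
    using calculation(1) assms(1) by (simp add: pos_divide_le_eq mult.commute)
  moreover have "(real (m choose 2) - 2 * (1 + \<alpha>) * real r) / \<alpha>
      \<le> (real (card S) - 2 * (1 + \<alpha>) * real r) / \<alpha>"
    using calculation(2) assms(1) by (intro divide_right_mono) auto
  ultimately show ?thesis by linarith
qed

section \<open>Choice of the clique size\<close>

theorem theorem2:
  fixes \<alpha> :: real and r :: nat and A :: algorithm
  assumes "\<alpha> > 0" and "r \<ge> 2" and "real r * \<alpha> \<ge> 1"
    and "\<forall>I \<in> instances \<alpha> r. solves_fuel_constrained A I"
  shows "\<forall>k::nat. k > 0 \<longrightarrow>
    (\<exists>G l. (G, l, \<alpha>) \<in> instances \<alpha> r \<and> card (nodes G) \<ge> k \<and>
       penalty A (G, l, \<alpha>) \<ge> (real (card (nodes G)))\<^sup>2 / (8 * \<alpha>))"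
proof (intro allI impI)
  fix k :: nat
  assume "k > 0"
  \<comment> \<open>Multiplied by 8\<alpha>, the goal becomes
    \<open>a * m + b \<le> 3 * m * m\<close>, where \<open>a\<close> and \<open>b\<close> are the
    two bracketed terms. With \<open>C = a + b\<close>, it follows from \<open>m \<ge> 1\<close> and
    \<open>m \<ge> C\<close>, since then \<open>a * m + b \<le> C * m \<le> m * m\<close>.\<close>
  define C where "C = (4 + 8 * \<alpha> + 2 * real r) +
    ((real r)\<^sup>2 + 16 * (1 + \<alpha>) * real r + 8 * \<alpha> * real r)"
  \<comment> \<open>The summand \<open>k\<close> ensures both \<open>m \<ge> 1\<close> and at least
    \<open>k\<close> nodes.\<close>
  define m where "m = nat \<lceil>C\<rceil> + k"
  let ?G = "lollipop r m"
  have m: "m > 0" "m \<ge> k" "real m \<ge> C" "real m \<ge> 1" and r: "r > 0"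
    using \<open>k > 0\<close> assms(2) unfolding m_def by (auto simp: le_nat_iff) linarith+
  have card: "card (nodes ?G) = r + m" by simp
  have inst: "(?G, 0, \<alpha>) \<in> instances \<alpha> r"
    using simple_connected_lollipop[OF r] eccentricity_lollipop[OF r m(1)] r
    by (auto simp: instances_def)
  have "real (m choose 2) = real m * (real m - 1) / 2"
    using m(1) by (simp add: choose_two real_of_nat_div of_nat_diff)
  then have choose: "8 * real (m choose 2) = 4 * (real m * real m) - 4 * real m"
    by (simp add: algebra_simps)
  have "C * real m \<ge> (4 + 8 * \<alpha> + 2 * real r) * real m +
      ((real r)\<^sup>2 + 16 * (1 + \<alpha>) * real r + 8 * \<alpha> * real r)"
    unfolding C_def using assms(1) m(4)
      mult_left_mono[OF m(4), of "(real r)\<^sup>2 + 16 * (1 + \<alpha>) * real r + 8 * \<alpha> * real r"]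
    by (simp add: algebra_simps)
  moreover have "C * real m \<le> real m * real m" using m(3) by (intro mult_right_mono) auto
  moreover have "0 \<le> real m * real m" by simp
  moreover have "(real (r + m))\<^sup>2 = (real r)\<^sup>2 + 2 * real r * real m + real m * real m"
    by (simp add: power2_eq_square algebra_simps)
  ultimately have "(real (r + m))\<^sup>2 \<le>
      8 * (real (m choose 2) - 2 * (1 + \<alpha>) * real r) - 8 * \<alpha> * (real m + real r)"
    using choose unfolding distrib_left distrib_right right_diff_distrib by linarith
  then have "(real (r + m))\<^sup>2 / (8 * \<alpha>) \<le>
      (8 * (real (m choose 2) - 2 * (1 + \<alpha>) * real r) - 8 * \<alpha> * (real m + real r)) / (8 * \<alpha>)"
    using assms(1) by (intro divide_right_mono) auto
  also have "\<dots> = (real (m choose 2) - 2 * (1 + \<alpha>) * real r) / \<alpha> - real m - real r"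
    using assms(1) by (simp add: field_simps)
  also have "\<dots> \<le> penalty A (?G, 0, \<alpha>)"
    using penalty_lollipop_ge[OF assms(1) r m(1)] inst assms(4) by blast
  finally show "\<exists>G l. (G, l, \<alpha>) \<in> instances \<alpha> r \<and> card (nodes G) \<ge> k \<and>
      penalty A (G, l, \<alpha>) \<ge> (real (card (nodes G)))\<^sup>2 / (8 * \<alpha>)"
    using inst m(2) card by (intro exI[of _ ?G] exI[of _ 0]) simp
qed

end
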